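(* Suppose that $v\in L^\infty_+$. Then $v\in\mathcal N_0$ if and only if $$\lambda_0(v):=\operatorname{ess\,inf}_{\mathbb Q\in\mathcal Q}\mathbb E_{\mathbb Q}(v\mid\mathcal F_0)=-\rho_0(-v)>0\ \text{ a.s.}\qquad\text{and}\qquad \frac1{\lambda_0(v)}\in L^\infty .$$
   Context: Let $(\Omega,\mathcal F,\mathbb P)$ be a probability space and $\mathcal F_0\subset\mathcal F$ a sub-$\sigma$-algebra (not necessarily trivial). $L^\infty=L^\infty(\mathcal F)$ and $L^1=L^1(\mathcal F)$ are taken with respect to $\mathbb P$; $L^\infty_+$ (resp. $L^\infty_-$) denotes the non-negative (resp. non-positive) elements. Fix a relevant coherent risk measure with the Fatou property $\rho:L^\infty\to\mathbb R$, used as a pricing functional, i.e.: $X\le Y$ implies $\rho(X)\le\rho(Y)$; $\rho(X+Y)\le\rho(X)+\rho(Y)$; $\rho(X+c)=\rho(X)+c$ for $c\in\mathbb R$; $\rho(aX)=a\rho(X)$ for real $a\ge0$; $\rho(X)\le\liminf_n\rho(X_n)$ whenever $(X_n)$ is uniformly bounded by $1$ and converges to $X$ in probability; $\rho(1_F)>0$ whenever $\mathbb P(F)>0$. Its acceptance set is $\mathcal A=\{X\in L^\infty:\rho(X)\le0\}$, and its set of test probabilities is $\mathcal Q=\{\mathbb Q\ll\mathbb P:\ \mathbb E(\tfrac{d\mathbb Q}{d\mathbb P}X)\le0\ \text{for all }X\in\mathcal A\}$, so that $\rho(X)=\sup_{\mathbb Q\in\mathcal Q}\mathbb E_{\mathbb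 Q}(X)$; $\mathcal Q$ contains a measure equivalent to $\mathbb P$. Define $\rho_0(X)=\operatorname{ess\,sup}\{\mathbb E_{\mathbb Q}(X\mid\mathcal F_0):\mathbb Q\in\mathcal Q\}$ and $\mathcal A_0=\{X\in L^\infty:\ \mathbb E_{\mathbb Q}(X\mid\mathcal F_0)\le0\text{ for all }\mathbb Q\in\mathcal Q\}=\{X\in L^\infty:\rho_0(X)\le0\text{ a.s.}\}$. Convention: $\mathbb E_{\mathbb Q}(\cdot\mid\mathcal F_0)$ is determined only $\mathbb Q$-a.s.; inequalities for it are understood $\mathbb Q$-a.s., and in an essential supremum (infimum) over $\mathcal Q$ the measure $\mathbb Q$ contributes only on $\{\mathbb E(\tfrac{d\mathbb Q}{d\mathbb P}\mid\mathcal F_0)>0\}$ (value $-\infty$, resp. $+\infty$, elsewhere). The set of numéraires at time zero is $\mathcal N_0=\{v\in L^\infty_+:\ L^\infty=\mathcal A_0+L^\infty(\mathcal F_0)\,v\}$. *)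

theory Defs
  imports "HOL-Probability.Probability"
begin

section \<open>Bounded random variables\<close>

text \<open>
  Elements of \<open>L\<^sup>\<infinity>\<close> are represented by measurable functions, not by equivalence classes;
  all order relations between them are almost sure ones. The time-zero \<open>\<sigma>\<close>-algebra is a measure
  \<open>F0\<close> of which only the measurable sets matter, as in \<^theory>\<open>HOL-Probability.Conditional_Expectation\<close>;
  its \<open>L\<^sup>\<infinity>\<close> is \<open>Linf (restr_to_subalg M F0)\<close>.
\<close>

definition Linf :: "'a measure \<Rightarrow> ('a \<Rightarrow> real) set" where
  "Linf M = {X \<in> borel_measurable M. \<exists>c. AE x in M. \<bar>X x\<bar> \<le> c}"

definition Linf_plus :: "'a measure \<Rightarrow> ('a \<Rightarrow> real) set" where
  "Linf_plus M = {X \<in> Linf M. AE x in M. 0 \<le> X x}"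

definition converges_in_probability ::
  "'a measure \<Rightarrow> (nat \<Rightarrow> 'a \<Rightarrow> real) \<Rightarrow> ('a \<Rightarrow> real) \<Rightarrow> bool" where
  "converges_in_probability M X Y \<longleftrightarrow>
     (\<forall>\<epsilon>>0. (\<lambda>n. measure M {x \<in> space M. \<bar>X n x - Y x\<bar> > \<epsilon>}) \<longlonglongrightarrow> 0)"

section \<open>Relevant coherent risk measures with the Fatou property\<close>

text \<open>The values of \<open>\<rho>\<close> outside \<open>Linf M\<close> are irrelevant.\<close>

locale relevant_fatou_coherent_risk_measure = prob_space M
  for M :: "'a measure" +
  fixes \<rho> :: "('a \<Rightarrow> real) \<Rightarrow> real"
  assumes mono: "\<lbrakk>X \<in> Linf M; Y \<in> Linf M; AE x in M. X x \<le> Y x\<rbrakk> \<Longrightarrow> \<rho> X \<le> \<rho> Y"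
    and subadditive: "\<lbrakk>X \<in> Linf M; Y \<in> Linf M\<rbrakk> \<Longrightarrow> \<rho> (\<lambda>x. X x + Y x) \<le> \<rho> X + \<rho> Y"
    and translation: "X \<in> Linf M \<Longrightarrow> \<rho> (\<lambda>x. X x + c) = \<rho> X + c"
    and pos_homogeneous: "\<lbrakk>X \<in> Linf M; 0 \<le> a\<rbrakk> \<Longrightarrow> \<rho> (\<lambda>x. a * X x) = a * \<rho> X"
    and fatou: "\<lbrakk>\<And>n. Xs n \<in> Linf M; \<And>n. AE x in M. \<bar>Xs n x\<bar> \<le> 1; X \<in> Linf M;
                 converges_in_probability M Xs X\<rbrakk>
               \<Longrightarrow> ereal (\<rho> X) \<le> liminf (\<lambda>n. ereal (\<rho> (Xs n)))"
    and relevant: "\<lbrakk>E \<in> sets M; 0 < measure M E\<rbrakk> \<Longrightarrow> 0 < \<rho> (indicator E)"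

definition acceptance_set :: "'a measure \<Rightarrow> (('a \<Rightarrow> real) \<Rightarrow> real) \<Rightarrow> ('a \<Rightarrow> real) set" where
  "acceptance_set M \<rho> = {X \<in> Linf M. \<rho> X \<le> 0}"

definition density_of :: "'a measure \<Rightarrow> 'a measure \<Rightarrow> 'a \<Rightarrow> real" where
  "density_of M Q = (\<lambda>x. enn2real (RN_deriv M Q x))"

definition test_probabilities :: "'a measure \<Rightarrow> (('a \<Rightarrow> real) \<Rightarrow> real) \<Rightarrow> 'a measure set" where
  "test_probabilities M \<rho> =
     {Q. prob_space Q \<and> sets Q = sets M \<and> absolutely_continuous M Q \<and>
         (\<forall>X \<in> acceptance_set M \<rho>. (LINT x|M. density_of M Q x * X x) \<le> 0)}"

section \<open>Essential suprema and infima of families\<close>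

text \<open>
  These are determined up to \<open>M\<close>-null sets only, and the descriptions below choose one version.
\<close>

definition is_ess_Sup :: "'a measure \<Rightarrow> ('a \<Rightarrow> ereal) set \<Rightarrow> ('a \<Rightarrow> ereal) \<Rightarrow> bool" where
  "is_ess_Sup M S g \<longleftrightarrow> g \<in> borel_measurable M \<and> (\<forall>f \<in> S. AE x in M. f x \<le> g x) \<and>
     (\<forall>h \<in> borel_measurable M. (\<forall>f \<in> S. AE x in M. f x \<le> h x) \<longrightarrow> (AE x in M. g x \<le> h x))"

definition ess_Sup :: "'a measure \<Rightarrow> ('a \<Rightarrow> ereal) set \<Rightarrow> 'a \<Rightarrow> ereal" where
  "ess_Sup M S = (SOME g. is_ess_Sup M S g)"

definition is_ess_Inf :: "'a measure \<Rightarrow> ('a \<Rightarrow> ereal) set \<Rightarrow> ('a \<Rightarrow> ereal) \<Rightarrow> bool" where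
  "is_ess_Inf M S g \<longleftrightarrow> g \<in> borel_measurable M \<and> (\<forall>f \<in> S. AE x in M. g x \<le> f x) \<and>
     (\<forall>h \<in> borel_measurable M. (\<forall>f \<in> S. AE x in M. h x \<le> f x) \<longrightarrow> (AE x in M. h x \<le> g x))"

definition ess_Inf :: "'a measure \<Rightarrow> ('a \<Rightarrow> ereal) set \<Rightarrow> 'a \<Rightarrow> ereal" where
  "ess_Inf M S = (SOME g. is_ess_Inf M S g)"

section \<open>Conditional prices, acceptance and numeraires at time zero\<close>

text \<open>
  The conditional expectation under \<open>Q\<close> is determined only \<open>Q\<close>-almost surely. It is therefore
  used only where the \<open>F0\<close>-conditional expectation of the density of \<open>Q\<close> is positive; elsewhere it
  is replaced by a value that does not affect the essential supremum or infimum.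
\<close>

definition density_support :: "'a measure \<Rightarrow> 'a measure \<Rightarrow> 'a measure \<Rightarrow> 'a set" where
  "density_support M F0 Q = {x \<in> space M. 0 < real_cond_exp M F0 (density_of M Q) x}"

definition rho0 ::
  "'a measure \<Rightarrow> 'a measure \<Rightarrow> (('a \<Rightarrow> real) \<Rightarrow> real) \<Rightarrow> ('a \<Rightarrow> real) \<Rightarrow> 'a \<Rightarrow> ereal" where
  "rho0 M F0 \<rho> X = ess_Sup M
     {(\<lambda>x. if x \<in> density_support M F0 Q then ereal (real_cond_exp Q F0 X x) else -\<infinity>)
      | Q. Q \<in> test_probabilities M \<rho>}"

definition lambda0 ::
  "'a measure \<Rightarrow> 'a measure \<Rightarrow> (('a \<Rightarrow> real) \<Rightarrow> real) \<Rightarrow> ('a \<Rightarrow> real) \<Rightarrow> 'a \<Rightarrow> ereal" where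
  "lambda0 M F0 \<rho> X = ess_Inf M
     {(\<lambda>x. if x \<in> density_support M F0 Q then ereal (real_cond_exp Q F0 X x) else \<infinity>)
      | Q. Q \<in> test_probabilities M \<rho>}"

definition acceptance_set0 ::
  "'a measure \<Rightarrow> 'a measure \<Rightarrow> (('a \<Rightarrow> real) \<Rightarrow> real) \<Rightarrow> ('a \<Rightarrow> real) set" where
  "acceptance_set0 M F0 \<rho> =
     {X \<in> Linf M. \<forall>Q \<in> test_probabilities M \<rho>. AE x in Q. real_cond_exp Q F0 X x \<le> 0}"

definition numeraires0 ::
  "'a measure \<Rightarrow> 'a measure \<Rightarrow> (('a \<Rightarrow> real) \<Rightarrow> real) \<Rightarrow> ('a \<Rightarrow> real) set" where
  "numeraires0 M F0 \<rho> =
     {v \<in> Linf_plus M.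
        Linf M = {(\<lambda>x. A x + h x * v x) | A h.
                    A \<in> acceptance_set0 M F0 \<rho> \<and> h \<in> Linf (restr_to_subalg M F0)}}"

end

theory Submission
  imports Defs
begin

text \<open>
  Both implications come from a constant bound. If \<open>v\<close> is a numeraire, decompose
  \<open>1 = A + h v\<close> with \<open>\<bar>h\<bar> \<le> c\<close>; conditioning under a test probability \<open>Q\<close> gives
  \<open>1 \<le> h E\<^sub>Q(v|F0) \<le> c E\<^sub>Q(v|F0)\<close>, so \<open>\<lambda>\<^sub>0(v) \<ge> 1/c\<close>. Conversely, if \<open>\<lambda>\<^sub>0(v) \<ge> 1/K\<close> and
  \<open>\<bar>X\<bar> \<le> c\<close>, then \<open>X - cKv\<close> has non-positive conditional expectation under every \<open>Q\<close>.
  The inequalities pass between \<open>Q\<close> and the reference measure because, on \<open>F0\<close>, the measure \<open>Q\<close>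
  is equivalent to the restriction of the reference measure to the density support of \<open>Q\<close>.
\<close>

section \<open>Existence of essential suprema and infima\<close>

text \<open>A bounded strictly increasing encoding of \<open>ereal\<close>: boundedness makes every
  integral finite, and strictness lets an equality of squashed values be undone. Since
  \<open>arctan\<close> stays within pi/2 < 2, the values 2 and -2 keep the infinities strictly
  outermost.\<close>

definition squash :: "ereal \<Rightarrow> real" where
  "squash x = (if x = \<infinity> then 2 else if x = -\<infinity> then -2 else arctan (real_of_ereal x))"

lemma abs_arctan_less_2: "\<bar>arctan x\<bar> < 2"
  using arctan_bounded[of x] pi_less_4 by linarith

lemma abs_squash_le: "\<bar>squash x\<bar> \<le> 2"
  using abs_arctan_less_2[of "real_of_ereal x"] by (auto simp: squash_def)

lemma strict_mono_squash: "strict_mono squash"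
proof (rule strict_monoI)
  fix x y :: ereal
  assume "x < y"
  then show "squash x < squash y"
    using abs_arctan_less_2[of "real_of_ereal x"] abs_arctan_less_2[of "real_of_ereal y"]
    by (cases x; cases y) (auto simp: squash_def arctan_less_iff)
qed

lemma borel_measurable_squash [measurable]: "squash \<in> borel_measurable borel"
  unfolding squash_def by measurable

text \<open>
  The essential supremum is the pointwise supremum over a countable subfamily maximizing the
  integral of the squashed supremum; adding a further member cannot increase this integral.
\<close>

lemma (in finite_measure) is_ess_Sup_exists:
  assumes S: "S \<subseteq> borel_measurable M"
  shows "\<exists>g. is_ess_Sup M S g"
proof -
  define G where "G C = (\<lambda>x. SUP f\<in>C. f x)" for C :: "('a \<Rightarrow> ereal) set"
  define I where "I C = (\<integral>x. squash (G C x) \<partial>M)" for C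
  define \<C> where "\<C> = {C. C \<subseteq> S \<and> countable C}"
  have G_meas: "G C \<in> borel_measurable M" if "C \<in> \<C>" for C
    using that S unfolding G_def \<C>_def by (intro borel_measurable_SUP) auto
  have int: "integrable M (\<lambda>x. squash (G C x))" if "C \<in> \<C>" for C
    using G_meas[OF that] abs_squash_le
    by (intro integrable_const_bound[where B = 2]) auto
  have G_mono: "squash (G C x) \<le> squash (G D x)" if "C \<subseteq> D" for C D x
    using that strict_mono_mono[OF strict_mono_squash]
    by (auto simp: G_def intro!: SUP_subset_mono elim: monoD)
  have I_mono: "I C \<le> I D" if "C \<in> \<C>" "D \<in> \<C>" "C \<subseteq> D" for C D
    unfolding I_def using that by (intro integral_mono int G_mono)
  \<comment> \<open>The empty subfamily has pointwise supremum \<open>-\<infinity>\<close>; it makes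
    the supremum \<open>a\<close> below one over a nonempty set even when \<open>S\<close> is
    empty.\<close>
  have ne: "{} \<in> \<C>"
    by (simp add: \<C>_def)
  have bdd: "bdd_above (I ` \<C>)"
  proof (rule bdd_aboveI2)
    fix C assume "C \<in> \<C>"
    then have "I C \<le> (\<integral>x. 2 \<partial>M)"
      unfolding I_def using abs_squash_le by (intro integral_mono int) (auto simp: abs_le_iff)
    then show "I C \<le> (\<integral>x. 2 \<partial>M)" .
  qed
  define a where "a = (SUP C\<in>\<C>. I C)"
  have "\<exists>C\<in>\<C>. a - 1 / Suc n < I C" for n
    using less_cSUP_iff[of \<C> I "a - 1 / Suc n"] ne bdd by (force simp: a_def)
  then obtain Cs where Cs: "\<And>n. Cs n \<in> \<C>" "\<And>n. a - 1 / Suc n < I (Cs n)"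
    by metis
  \<comment> \<open>A countable union of countable families is still admissible, and it dominates
    every member of the maximizing sequence, so the supremum \<open>a\<close> is attained.\<close>
  define C where "C = (\<Union>n. Cs n)"
  have C: "C \<in> \<C>"
    using Cs(1) by (auto simp: C_def \<C>_def)
  have "a \<le> I C"
  proof (rule LIMSEQ_le_const2)
    show "(\<lambda>n. a - 1 / Suc n) \<longlonglongrightarrow> a"
      by (rule tendsto_eq_intros LIMSEQ_inverse_real_of_nat[unfolded inverse_eq_divide] | simp)+
    have "a - 1 / Suc n \<le> I C" for n
      using Cs(2)[of n] I_mono[OF Cs(1) C, of n] by (force simp: C_def)
    then show "\<exists>N. \<forall>n\<ge>N. a - 1 / real (Suc n) \<le> I C"
      by blast
  qed
  have "AE x in M. f x \<le> G C x" if "f \<in> S" for f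
  proof -
    have D: "insert f C \<in> \<C>"
      using C that by (auto simp: \<C>_def)
    have "I (insert f C) \<le> a"
      unfolding a_def using D bdd by (rule cSUP_upper)
    then have "I (insert f C) = I C"
      using \<open>a \<le> I C\<close> I_mono[OF C D subset_insertI] by linarith
    then have "(\<integral>x. squash (G (insert f C) x) - squash (G C x) \<partial>M) = 0"
      by (simp add: I_def int C D)
    \<comment> \<open>The difference is nonnegative and integrates to zero, so it vanishes almost
      surely; injectivity of \<open>squash\<close> then gives equality of the suprema
      themselves.\<close>
    then have "AE x in M. squash (G (insert f C) x) - squash (G C x) = 0"
      using int C D G_mono[of C "insert f C"]
      by (subst (asm) integral_nonneg_eq_0_iff_AE) auto
    then show ?thesis
    proof eventually_elim
      case (elim x)
      then have "G (insert f C) x = G C x"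
        using strict_mono_eq[OF strict_mono_squash] by simp
      then show ?case
        by (metis G_def SUP_upper insertI1)
    qed
  qed
  moreover have "AE x in M. G C x \<le> h x" if "\<forall>f\<in>S. AE x in M. f x \<le> h x" for h
  proof -
    \<comment> \<open>Countability of \<open>C\<close> merges the exceptional null sets of its
      members into one.\<close>
    have "AE x in M. \<forall>f\<in>C. f x \<le> h x"
      using C that by (subst AE_ball_countable) (auto simp: \<C>_def)
    then show ?thesis
      by eventually_elim (auto simp: G_def SUP_le_iff)
  qed
  ultimately show ?thesis
    using G_meas[OF C] unfolding is_ess_Sup_def by blast
qed

text \<open>Negation reverses the order. The families share an index set and are related only almost
  surely, because conditional expectations of \<open>X\<close> and of its negative are opposite only
  up to null sets.\<close>

lemma is_ess_Inf_uminus: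
  assumes "is_ess_Sup M (f ` T) g" "\<And>t. t \<in> T \<Longrightarrow> AE x in M. k t x = - f t x"
  shows "is_ess_Inf M (k ` T) (\<lambda>x. - g x)"
  unfolding is_ess_Inf_def
proof (intro conjI ballI impI)
  show "(\<lambda>x. - g x) \<in> borel_measurable M"
    using assms(1) by (auto simp: is_ess_Sup_def)
  fix u assume "u \<in> k ` T"
  then obtain t where t: "t \<in> T" "u = k t"
    by auto
  have "AE x in M. f t x \<le> g x"
    using assms(1) t by (auto simp: is_ess_Sup_def)
  with assms(2)[OF t(1)] show "AE x in M. - g x \<le> u x"
    by eventually_elim (simp add: t)
next
  fix h :: "'a \<Rightarrow> ereal"
  assume h: "h \<in> borel_measurable M" "\<forall>u\<in>k ` T. AE x in M. h x \<le> u x"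
  have "AE x in M. f t x \<le> - h x" if "t \<in> T" for t
  proof -
    have "AE x in M. h x \<le> k t x"
      using h that by auto
    with assms(2)[OF that] show ?thesis
      by eventually_elim (metis ereal_minus_le_minus ereal_uminus_uminus)
  qed
  then have "AE x in M. g x \<le> - h x"
    using assms(1) h(1) by (auto simp: is_ess_Sup_def)
  then show "AE x in M. h x \<le> - g x"
    by eventually_elim (metis ereal_minus_le_minus ereal_uminus_uminus)
qed

lemma is_ess_Inf_unique:
  assumes "is_ess_Inf M S g" "is_ess_Inf M S h"
  shows "AE x in M. g x = h x"
proof -
  have "AE x in M. g x \<le> h x" "AE x in M. h x \<le> g x"
    using assms by (auto simp: is_ess_Inf_def)
  then show ?thesis
    by eventually_elim auto
qed

lemma (in finite_measure) is_ess_Sup_ess_Sup: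
  assumes "S \<subseteq> borel_measurable M"
  shows "is_ess_Sup M S (ess_Sup M S)"
  unfolding ess_Sup_def using is_ess_Sup_exists[OF assms] by (rule someI_ex)

lemma (in finite_measure) is_ess_Inf_ess_Inf:
  assumes "S \<subseteq> borel_measurable M"
  shows "is_ess_Inf M S (ess_Inf M S)"
proof -
  let ?f = "\<lambda>k x. - k x :: ereal"
  have "?f ` S \<subseteq> borel_measurable M"
    using assms by auto
  then obtain g where "is_ess_Sup M (?f ` S) g"
    using is_ess_Sup_exists by blast
  then have "is_ess_Inf M ((\<lambda>k. k) ` S) (\<lambda>x. - g x)"
    by (rule is_ess_Inf_uminus) simp
  then show ?thesis
    unfolding ess_Inf_def image_ident by (rule someI[where P = "is_ess_Inf M S"])
qed

section \<open>Almost sure statements under an absolutely continuous measure\<close>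

lemma Linf_integrable:
  assumes "finite_measure M" "X \<in> Linf M"
  shows "integrable M X"
  using assms by (auto simp: Linf_def intro!: finite_measure.integrable_const_bound)

lemma Linf_mult: "X \<in> Linf M \<Longrightarrow> Y \<in> Linf M \<Longrightarrow> (\<lambda>x. X x * Y x) \<in> Linf M"
proof -
  assume "X \<in> Linf M" "Y \<in> Linf M"
  then obtain c d where "X \<in> borel_measurable M" "Y \<in> borel_measurable M"
    and "AE x in M. \<bar>X x\<bar> \<le> c" "AE x in M. \<bar>Y x\<bar> \<le> d"
    by (auto simp: Linf_def)
  moreover from this(3,4) have "AE x in M. \<bar>X x * Y x\<bar> \<le> c * d"
    by eventually_elim (auto simp: abs_mult intro!: mult_mono)
  ultimately show "(\<lambda>x. X x * Y x) \<in> Linf M"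
    by (auto simp: Linf_def)
qed

lemma Linf_add: "X \<in> Linf M \<Longrightarrow> Y \<in> Linf M \<Longrightarrow> (\<lambda>x. X x + Y x) \<in> Linf M"
proof -
  assume "X \<in> Linf M" "Y \<in> Linf M"
  then obtain c d where "X \<in> borel_measurable M" "Y \<in> borel_measurable M"
    and "AE x in M. \<bar>X x\<bar> \<le> c" "AE x in M. \<bar>Y x\<bar> \<le> d"
    by (auto simp: Linf_def)
  moreover from this(3,4) have "AE x in M. \<bar>X x + Y x\<bar> \<le> c + d"
    by eventually_elim auto
  ultimately show "(\<lambda>x. X x + Y x) \<in> Linf M"
    by (auto simp: Linf_def)
qed

lemma Linf_const [simp]: "(\<lambda>x. c) \<in> Linf M"
  by (auto simp: Linf_def)

lemma Linf_restr_to_subalg: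
  assumes "subalgebra M F" "h \<in> Linf (restr_to_subalg M F)"
  shows "h \<in> borel_measurable F" "h \<in> Linf M"
proof -
  show h: "h \<in> borel_measurable F"
    using assms measurable_in_subalg' by (auto simp: Linf_def)
  obtain c where "AE x in restr_to_subalg M F. \<bar>h x\<bar> \<le> c"
    using assms by (auto simp: Linf_def)
  then have "AE x in M. \<bar>h x\<bar> \<le> c"
    by (rule AE_restr_to_subalg[OF assms(1)])
  then show "h \<in> Linf M"
    using measurable_from_subalg[OF assms(1) h] by (auto simp: Linf_def)
qed

section \<open>An absolutely continuous probability and its conditional density\<close>

locale absolutely_continuous_prob = M: prob_space M + Q: prob_space Q
  for M Q :: "'a measure" +
  fixes F :: "'a measure"
  assumes sets_Q: "sets Q = sets M"
    and abs_cont: "absolutely_continuous M Q"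
    and subalg: "subalgebra M F"
begin

lemma space_Q: "space Q = space M"
  using sets_Q by (rule sets_eq_imp_space_eq)

lemma space_F: "space F = space M"
  using subalg by (simp add: subalgebra_def)

lemma subalg_Q: "subalgebra Q F"
  using subalg by (simp add: subalgebra_def sets_Q space_Q)

sublocale MF: finite_measure_subalgebra M F
  using subalg by unfold_locales

sublocale QF: finite_measure_subalgebra Q F
  using subalg_Q by unfold_locales

lemma AE_Q: "AE x in M. P x \<Longrightarrow> AE x in Q. P x"
  using sets_Q abs_cont by (rule absolutely_continuous_AE)

lemma Linf_Q: "X \<in> Linf M \<Longrightarrow> X \<in> Linf Q"
  using AE_Q measurable_cong_sets[OF sets_Q refl] by (auto simp: Linf_def)

lemma borel_measurable_density_of [measurable]: "density_of M Q \<in> borel_measurable M"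
  unfolding density_of_def by measurable

lemma density_of_nonneg: "0 \<le> density_of M Q x"
  by (simp add: density_of_def)

text \<open>The conversion \<open>enn2real\<close> loses nothing up to null sets: \<open>Q\<close>
  is finite, so its Radon-Nikodym derivative is finite almost everywhere.\<close>

lemma density_density_of: "density M (\<lambda>x. ennreal (density_of M Q x)) = Q"
proof -
  have "AE x in M. RN_deriv M Q x \<noteq> \<infinity>"
    using abs_cont sets_Q by (intro M.RN_deriv_finite) unfold_locales
  then have "AE x in M. ennreal (density_of M Q x) = RN_deriv M Q x"
    by eventually_elim (auto simp: density_of_def less_top)
  then have "density M (\<lambda>x. ennreal (density_of M Q x)) = density M (RN_deriv M Q)"
    by (intro density_cong) auto
  then show ?thesis
    using M.density_RN_deriv[OF abs_cont sets_Q] by simp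
qed

lemma integrable_density_of: "integrable M (density_of M Q)"
proof -
  have "integrable (density M (\<lambda>x. ennreal (density_of M Q x))) (\<lambda>x. 1 :: real)"
    by (subst density_density_of) simp
  then show ?thesis
    by (subst (asm) integrable_real_density) (auto simp: density_of_nonneg)
qed

text \<open>On sets of \<open>F\<close> the density can be replaced by its conditional expectation,
  which is thus the density of \<open>Q\<close> restricted to \<open>F\<close>.\<close>

lemma measure_Q_eq:
  assumes "A \<in> sets F"
  shows "measure Q A = (\<integral>x\<in>A. real_cond_exp M F (density_of M Q) x \<partial>M)"
proof -
  have A: "A \<in> sets M"
    using assms subalg by (auto simp: subalgebra_def)
  have "measure Q A = (\<integral>x. indicator A x \<partial>density M (\<lambda>x. ennreal (density_of M Q x)))"
    using A by (simp add: density_density_of sets_Q)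
  also have "\<dots> = (\<integral>x\<in>A. density_of M Q x \<partial>M)"
    using A by (subst integral_real_density)
      (auto simp: density_of_nonneg set_lebesgue_integral_def mult.commute)
  also have "\<dots> = (\<integral>x\<in>A. real_cond_exp M F (density_of M Q) x \<partial>M)"
    using integrable_density_of assms by (rule MF.real_cond_exp_intA)
  finally show ?thesis .
qed

lemma density_support_sets: "density_support M F Q \<in> sets F"
proof -
  have "{x \<in> space F. 0 < real_cond_exp M F (density_of M Q) x} \<in> sets F"
    by measurable
  then show ?thesis
    by (simp add: density_support_def space_F)
qed

lemma density_support_sets_M [measurable]: "density_support M F Q \<in> sets M"
  using density_support_sets subalg by (auto simp: subalgebra_def)

lemma AE_density_support: "AE x in Q. x \<in> density_support M F Q"
proof -
  let ?N = "space F - density_support M F Q"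
  have N: "?N \<in> sets F"
    using density_support_sets by auto
  \<comment> \<open>Outside the support the conditional density is at most 0, so its integral over
    \<open>?N\<close>, which is the \<open>Q\<close>-measure of \<open>?N\<close>, cannot be
    positive.\<close>
  have "0 \<le> (\<integral>x. - (indicator ?N x *\<^sub>R real_cond_exp M F (density_of M Q) x) \<partial>M)"
    by (rule Bochner_Integration.integral_nonneg)
      (auto simp: density_support_def space_F indicator_def)
  then have "measure Q ?N \<le> 0"
    by (simp add: measure_Q_eq[OF N] set_lebesgue_integral_def)
  then have "emeasure Q ?N = 0"
    by (simp add: Q.emeasure_eq_measure measure_le_0_iff)
  then show ?thesis
    using N subalg_Q by (intro AE_I[of _ _ ?N]) (auto simp: subalgebra_def)
qed

text \<open>The exceptional set inside the support is a \<open>Q\<close>-null set of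
  \<open>F\<close> on which the conditional density is strictly positive, hence it is
  \<open>M\<close>-null. Membership in \<open>F\<close> is essential: the density itself may vanish
  on part of the support.\<close>

lemma AE_on_density_support:
  assumes P: "{x \<in> space M. P x} \<in> sets F" and "AE x in Q. P x"
  shows "AE x in M. x \<in> density_support M F Q \<longrightarrow> P x"
proof -
  let ?D = "real_cond_exp M F (density_of M Q)"
  let ?N = "density_support M F Q - {x \<in> space M. P x}"
  have N: "?N \<in> sets F"
    using density_support_sets P by auto
  then have NM [measurable]: "?N \<in> sets M"
    using subalg by (auto simp: subalgebra_def)
  have "AE x in Q. x \<notin> ?N"
    using assms(2) AE_space by eventually_elim (simp add: space_Q)
  then have "emeasure Q ?N = 0"
    using NM by (subst (asm) AE_iff_measurable[of ?N])
      (auto simp: sets_Q space_Q density_support_def)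
  then have "measure Q ?N = 0"
    by (simp add: Q.emeasure_eq_measure)
  then have "(\<integral>x. indicator ?N x * ?D x \<partial>M) = 0"
    unfolding measure_Q_eq[OF N] by (simp add: set_lebesgue_integral_def)
  moreover have "integrable M (\<lambda>x. indicator ?N x * ?D x)"
    using integrable_mult_indicator[OF NM MF.real_cond_exp_int(1)[OF integrable_density_of]] by simp
  ultimately have "AE x in M. indicator ?N x * ?D x = 0"
    by (subst (asm) integral_nonneg_eq_0_iff_AE) (auto simp: density_support_def indicator_def)
  with AE_space show ?thesis
    by eventually_elim (auto simp: density_support_def indicator_def split: if_splits)
qed

text \<open>The reverse transfer, for arbitrary \<open>P\<close>: absolute continuity carries the
  implication over to \<open>Q\<close>, and \<open>Q\<close>-almost every point lies in the
  support.\<close>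

lemma AE_Q_if_on_density_support:
  assumes "AE x in M. x \<in> density_support M F Q \<longrightarrow> P x"
  shows "AE x in Q. P x"
  using AE_Q[OF assms] AE_density_support by eventually_elim auto

lemma real_cond_exp_Q_meas_M [measurable]: "real_cond_exp Q F X \<in> borel_measurable M"
  by (rule measurable_from_subalg[OF subalg]) simp

lemma real_cond_exp_Q_uminus:
  assumes "X \<in> Linf M"
  shows "AE x in M. x \<in> density_support M F Q \<longrightarrow>
           real_cond_exp Q F (\<lambda>x. - X x) x = - real_cond_exp Q F X x"
proof (rule AE_on_density_support)
  have "integrable Q X"
    using assms by (intro Linf_integrable Linf_Q) unfold_locales
  then show "AE x in Q. real_cond_exp Q F (\<lambda>x. - X x) x = - real_cond_exp Q F X x"
    using QF.real_cond_exp_cmult[of X "-1"] by simp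
  have "{x \<in> space F. real_cond_exp Q F (\<lambda>x. - X x) x = - real_cond_exp Q F X x} \<in> sets F"
    by measurable
  then show "{x \<in> space M. real_cond_exp Q F (\<lambda>x. - X x) x = - real_cond_exp Q F X x} \<in> sets F"
    by (simp add: space_F)
qed

end

section \<open>Numeraires\<close>

lemma test_probabilitiesD:
  assumes "prob_space M" "subalgebra M F" "Q \<in> test_probabilities M \<rho>"
  shows "absolutely_continuous_prob M Q F"
  using assms by (auto simp: test_probabilities_def absolutely_continuous_prob_def
      absolutely_continuous_prob_axioms_def)

text \<open>Justifies the choice operator behind \<open>lambda0\<close>: each member of the family
  is measurable, so an essential infimum exists and the chosen function is one.\<close>

lemma is_ess_Inf_lambda0:
  assumes "prob_space M" "subalgebra M F"
  shows "is_ess_Inf M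
     ((\<lambda>Q x. if x \<in> density_support M F Q then ereal (real_cond_exp Q F X x) else \<infinity>)
       ` test_probabilities M \<rho>) (lambda0 M F \<rho> X)"
  unfolding lambda0_def Setcompr_eq_image
proof (rule finite_measure.is_ess_Inf_ess_Inf)
  show "finite_measure M"
    using assms(1) by (rule prob_space.finite_measure)
  show "(\<lambda>Q x. if x \<in> density_support M F Q then ereal (real_cond_exp Q F X x) else \<infinity>)
          ` test_probabilities M \<rho> \<subseteq> borel_measurable M"
  proof safe
    fix Q assume "Q \<in> test_probabilities M \<rho>"
    then interpret absolutely_continuous_prob M Q F
      using assms by (intro test_probabilitiesD)
    show "(\<lambda>x. if x \<in> density_support M F Q then ereal (real_cond_exp Q F X x) else \<infinity>)
            \<in> borel_measurable M"
      by measurable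
  qed
qed

lemma is_ess_Sup_rho0:
  assumes "prob_space M" "subalgebra M F"
  shows "is_ess_Sup M
     ((\<lambda>Q x. if x \<in> density_support M F Q then ereal (real_cond_exp Q F X x) else -\<infinity>)
       ` test_probabilities M \<rho>) (rho0 M F \<rho> X)"
  unfolding rho0_def Setcompr_eq_image
proof (rule finite_measure.is_ess_Sup_ess_Sup)
  show "finite_measure M"
    using assms(1) by (rule prob_space.finite_measure)
  show "(\<lambda>Q x. if x \<in> density_support M F Q then ereal (real_cond_exp Q F X x) else -\<infinity>)
          ` test_probabilities M \<rho> \<subseteq> borel_measurable M"
  proof safe
    fix Q assume "Q \<in> test_probabilities M \<rho>"
    then interpret absolutely_continuous_prob M Q F
      using assms by (intro test_probabilitiesD)
    show "(\<lambda>x. if x \<in> density_support M F Q then ereal (real_cond_exp Q F X x) else -\<infinity>)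
            \<in> borel_measurable M"
      by measurable
  qed
qed

text \<open>Both sides are essential infima of the same family, and these are unique up to null
  sets. Off the support the conventional values \<open>\<infinity>\<close> and
  \<open>-\<infinity>\<close> are opposite to each other.\<close>

lemma lambda0_eq_uminus_rho0:
  assumes "prob_space M" "subalgebra M F" "X \<in> Linf M"
  shows "AE x in M. lambda0 M F \<rho> X x = - rho0 M F \<rho> (\<lambda>x. - X x) x"
proof (rule is_ess_Inf_unique[OF is_ess_Inf_lambda0[OF assms(1,2)]
      is_ess_Inf_uminus[OF is_ess_Sup_rho0[OF assms(1,2)]]])
  fix Q assume "Q \<in> test_probabilities M \<rho>"
  then interpret absolutely_continuous_prob M Q F
    using assms by (intro test_probabilitiesD)
  show "AE x in M.
      (if x \<in> density_support M F Q then ereal (real_cond_exp Q F X x) else \<infinity>) =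
      - (if x \<in> density_support M F Q
         then ereal (real_cond_exp Q F (\<lambda>x. - X x) x) else -\<infinity>)"
    using real_cond_exp_Q_uminus[OF assms(3)] by eventually_elim auto
qed

text \<open>A constant is a measurable competitor, so it lies below the essential infimum exactly
  when it lies below every member. Off the support the value \<open>\<infinity>\<close> makes this
  trivial; on it, the bound transfers between \<open>M\<close> and \<open>Q\<close>.\<close>

lemma const_le_lambda0_iff:
  assumes "prob_space M" "subalgebra M F"
  shows "(AE x in M. ereal c \<le> lambda0 M F \<rho> X x) \<longleftrightarrow>
         (\<forall>Q\<in>test_probabilities M \<rho>. AE x in Q. c \<le> real_cond_exp Q F X x)"
    (is "?L \<longleftrightarrow> ?R")
proof -
  let ?k = "\<lambda>Q x. if x \<in> density_support M F Q then ereal (real_cond_exp Q F X x) else \<infinity>"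
  note inf = is_ess_Inf_lambda0[OF assms, of X \<rho>]
  have "?L \<longleftrightarrow> (\<forall>Q\<in>test_probabilities M \<rho>. AE x in M. ereal c \<le> ?k Q x)" (is "_ \<longleftrightarrow> ?B")
  proof
    assume L: ?L
    show ?B
    proof
      fix Q assume "Q \<in> test_probabilities M \<rho>"
      then have "AE x in M. lambda0 M F \<rho> X x \<le> ?k Q x"
        using inf by (simp add: is_ess_Inf_def)
      with L show "AE x in M. ereal c \<le> ?k Q x"
        by eventually_elim (rule order.trans)
    qed
  next
    assume ?B
    then have "\<forall>f\<in>?k ` test_probabilities M \<rho>. AE x in M. ereal c \<le> f x"
      by simp
    with inf show ?L
      by (auto simp only: is_ess_Inf_def borel_measurable_const)
  qed
  also have "\<dots> \<longleftrightarrow> ?R"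
  proof (rule ball_cong[OF refl])
    fix Q assume "Q \<in> test_probabilities M \<rho>"
    then interpret absolutely_continuous_prob M Q F
      using assms by (intro test_probabilitiesD)
    have "{x \<in> space F. c \<le> real_cond_exp Q F X x} \<in> sets F"
      by measurable
    then have "{x \<in> space M. c \<le> real_cond_exp Q F X x} \<in> sets F"
      by (simp add: space_F)
    then have "(AE x in Q. c \<le> real_cond_exp Q F X x) \<longleftrightarrow>
        (AE x in M. x \<in> density_support M F Q \<longrightarrow> c \<le> real_cond_exp Q F X x)"
      by (rule iffI[OF AE_on_density_support AE_Q_if_on_density_support])
    also have "\<dots> \<longleftrightarrow> (AE x in M. ereal c \<le> ?k Q x)"
      by (intro AE_cong) simp
    finally show "(AE x in M. ereal c \<le> ?k Q x) \<longleftrightarrow> (AE x in Q. c \<le> real_cond_exp Q F X x)" ..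
  qed
  finally show ?thesis .
qed

section \<open>Numeraires and uniform lower bounds on conditional prices\<close>

lemma numeraire_imp_lower_bound:
  assumes "prob_space M" "subalgebra M F" "v \<in> numeraires0 M F \<rho>"
  obtains c where "0 < c" "\<forall>Q\<in>test_probabilities M \<rho>. AE x in Q. c \<le> real_cond_exp Q F v x"
proof -
  have v: "v \<in> Linf M" "AE x in M. 0 \<le> v x"
    using assms(3) by (auto simp: numeraires0_def Linf_plus_def)
  have "(\<lambda>x. 1) \<in> Linf M"
    by simp
  then obtain A h where Ah: "(\<lambda>x. 1) = (\<lambda>x. A x + h x * v x)"
    and A: "A \<in> acceptance_set0 M F \<rho>" and h: "h \<in> Linf (restr_to_subalg M F)"
    using assms(3) unfolding numeraires0_def by blast
  have AM: "A \<in> Linf M"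
    using A by (simp add: acceptance_set0_def)
  note hF = Linf_restr_to_subalg[OF assms(2) h]
  obtain b where b: "AE x in M. \<bar>h x\<bar> \<le> b"
    using hF(2) by (auto simp: Linf_def)
  \<comment> \<open>The maximum with 1 guarantees that \<open>1 / c\<close> is a positive
    bound.\<close>
  define c where "c = max b 1"
  have "AE x in Q. 1 / c \<le> real_cond_exp Q F v x" if Q: "Q \<in> test_probabilities M \<rho>" for Q
  proof -
    interpret absolutely_continuous_prob M Q F
      using assms Q by (intro test_probabilitiesD)
    have fin: "finite_measure Q"
      by unfold_locales
    have int: "integrable Q A" "integrable Q (\<lambda>x. h x * v x)"
      using AM hF v fin by (auto intro!: Linf_integrable Linf_Q Linf_mult)
    have "AE x in Q. real_cond_exp Q F (\<lambda>x. 1) x = 1"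
      by (rule QF.real_cond_exp_F_meas) auto
    moreover have "AE x in Q. real_cond_exp Q F (\<lambda>x. A x + h x * v x) x =
        real_cond_exp Q F A x + real_cond_exp Q F (\<lambda>x. h x * v x) x"
      using int by (rule QF.real_cond_exp_add)
    moreover have "AE x in Q. real_cond_exp Q F (\<lambda>x. h x * v x) x = h x * real_cond_exp Q F v x"
      using hF(1) Linf_Q[OF v(1)] int(2) by (intro QF.real_cond_exp_mult) (auto simp: Linf_def)
    moreover have "AE x in Q. real_cond_exp Q F A x \<le> 0"
      using A Q by (auto simp: acceptance_set0_def)
    moreover have "AE x in Q. \<bar>h x\<bar> \<le> b"
      using b by (rule AE_Q)
    moreover have "AE x in Q. 0 \<le> real_cond_exp Q F v x"
      using AE_Q[OF v(2)] Linf_Q[OF v(1)] by (intro QF.real_cond_exp_pos) (auto simp: Linf_def)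
    ultimately show ?thesis
    proof eventually_elim
      case (elim x)
      have "1 \<le> h x * real_cond_exp Q F v x"
        using elim(1-4) Ah by simp
      \<comment> \<open>Replacing \<open>h\<close> by its bound preserves the inequality because the
        conditional price of \<open>v\<close> is nonnegative.\<close>
      also have "\<dots> \<le> c * real_cond_exp Q F v x"
        using elim(5,6) by (intro mult_right_mono) (auto simp: c_def)
      finally show ?case
        by (simp add: c_def divide_le_eq mult.commute)
    qed
  qed
  then show ?thesis
    by (intro that[of "1 / c"]) (auto simp: c_def)
qed

lemma lower_bound_imp_numeraire:
  assumes "prob_space M" "subalgebra M F" "v \<in> Linf_plus M"
    and c: "0 < c" "\<forall>Q\<in>test_probabilities M \<rho>. AE x in Q. c \<le> real_cond_exp Q F v x"
  shows "v \<in> numeraires0 M F \<rho>"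
proof -
  have v: "v \<in> Linf M"
    using assms(3) by (simp add: Linf_plus_def)
  have "\<exists>A h. X = (\<lambda>x. A x + h x * v x) \<and> A \<in> acceptance_set0 M F \<rho> \<and>
          h \<in> Linf (restr_to_subalg M F)" if X: "X \<in> Linf M" for X
  proof -
    obtain b where b: "AE x in M. \<bar>X x\<bar> \<le> b"
      using X by (auto simp: Linf_def)
    \<comment> \<open>Nonnegativity of \<open>d\<close> allows the lower bound on the price of
      \<open>v\<close> to be multiplied by \<open>d / c\<close>. Holding the constant amount
      \<open>d / c\<close> of \<open>v\<close> then offsets the worst case \<open>d\<close> of
      \<open>X\<close>.\<close>
    define d where "d = max b 0"
    let ?A = "\<lambda>x. X x + (- d / c) * v x"
    have AM: "?A \<in> Linf M"
      using X v by (intro Linf_add Linf_mult) auto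
    have "AE x in Q. real_cond_exp Q F ?A x \<le> 0" if Q: "Q \<in> test_probabilities M \<rho>" for Q
    proof -
      interpret absolutely_continuous_prob M Q F
        using assms Q by (intro test_probabilitiesD)
      have fin: "finite_measure Q"
        by unfold_locales
      have int: "integrable Q X" "integrable Q v"
        using X v fin by (auto intro!: Linf_integrable Linf_Q)
      have "AE x in Q. real_cond_exp Q F ?A x =
          real_cond_exp Q F X x + real_cond_exp Q F (\<lambda>x. (- d / c) * v x) x"
        using int by (intro QF.real_cond_exp_add) auto
      moreover have "AE x in Q. real_cond_exp Q F (\<lambda>x. (- d / c) * v x) x =
          (- d / c) * real_cond_exp Q F v x"
        using int(2) by (rule QF.real_cond_exp_cmult)
      moreover have "AE x in Q. real_cond_exp Q F X x \<le> d"
      proof (rule QF.real_cond_exp_le_c)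
        show "AE x in Q. X x \<le> d"
          using AE_Q[OF b] by eventually_elim (auto simp: d_def)
      qed (rule int)
      ultimately show ?thesis
        using bspec[OF c(2) Q]
      proof eventually_elim
        case (elim x)
        have "d = (d / c) * c"
          using c(1) by simp
        also have "\<dots> \<le> (d / c) * real_cond_exp Q F v x"
          using elim(4) c(1) by (intro mult_left_mono) (auto simp: d_def)
        finally show ?case
          using elim(1-3) by simp
      qed
    qed
    then have "?A \<in> acceptance_set0 M F \<rho>"
      using AM by (simp add: acceptance_set0_def)
    moreover have "X = (\<lambda>x. ?A x + d / c * v x)"
      by (simp add: fun_eq_iff)
    moreover have "(\<lambda>x. d / c) \<in> Linf (restr_to_subalg M F)"
      by simp
    ultimately show ?thesis
      by (intro exI[of _ ?A] exI[of _ "\<lambda>x. d / c"]) simp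
  qed
  \<comment> \<open>The opposite inclusion in the set equality that defines numeraires.\<close>
  moreover have "(\<lambda>x. A x + h x * v x) \<in> Linf M"
    if "A \<in> acceptance_set0 M F \<rho>" "h \<in> Linf (restr_to_subalg M F)" for A h
    using that v Linf_restr_to_subalg(2)[OF assms(2)]
    by (intro Linf_add Linf_mult) (auto simp: acceptance_set0_def)
  ultimately show ?thesis
    using assms(3) unfolding numeraires0_def by blast
qed

lemma numeraires0_iff:
  assumes "prob_space M" "subalgebra M F" "v \<in> Linf_plus M"
  shows "v \<in> numeraires0 M F \<rho> \<longleftrightarrow> (\<exists>c>0. AE x in M. ereal c \<le> lambda0 M F \<rho> v x)"
  unfolding const_le_lambda0_iff[OF assms(1,2)]
proof
  assume "v \<in> numeraires0 M F \<rho>"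
  then show "\<exists>c>0. \<forall>Q\<in>test_probabilities M \<rho>. AE x in Q. c \<le> real_cond_exp Q F v x"
    by (rule numeraire_imp_lower_bound[OF assms(1,2)]) blast
next
  assume "\<exists>c>0. \<forall>Q\<in>test_probabilities M \<rho>. AE x in Q. c \<le> real_cond_exp Q F v x"
  then obtain c where "0 < c" "\<forall>Q\<in>test_probabilities M \<rho>. AE x in Q. c \<le> real_cond_exp Q F v x"
    by blast
  then show "v \<in> numeraires0 M F \<rho>"
    by (rule lower_bound_imp_numeraire[OF assms])
qed

text \<open>Positivity has to accompany boundedness: where \<open>g\<close> is 0 the reciprocal is
  \<open>\<infinity>\<close>, which \<open>real_of_ereal\<close> sends to 0, so the bound alone
  would miss such points. Where \<open>g\<close> is \<open>\<infinity>\<close> the reciprocal is 0,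
  and both sides hold there trivially.\<close>

lemma one_divide_in_Linf_iff:
  assumes [measurable]: "g \<in> borel_measurable M"
  shows "(\<exists>c>0. AE x in M. ereal c \<le> g x) \<longleftrightarrow>
         (AE x in M. 0 < g x) \<and> (\<lambda>x. real_of_ereal (1 / g x)) \<in> Linf M"
proof (intro iffI conjI; elim exE conjE)
  fix c :: real
  assume c: "0 < c" "AE x in M. ereal c \<le> g x"
  from c(2) show "AE x in M. 0 < g x"
    by eventually_elim (use c(1) in \<open>metis ereal_less(2) less_le_trans\<close>)
next
  fix c :: real
  assume c: "0 < c" "AE x in M. ereal c \<le> g x"
  from c(2) have "AE x in M. \<bar>real_of_ereal (1 / g x)\<bar> \<le> 1 / c"
  proof eventually_elim
    case (elim x)
    then show ?case
      using c(1) by (cases "g x") (auto simp: one_ereal_def frac_le)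
  qed
  then show "(\<lambda>x. real_of_ereal (1 / g x)) \<in> Linf M"
    by (auto simp: Linf_def)
next
  assume pos: "AE x in M. 0 < g x" and "(\<lambda>x. real_of_ereal (1 / g x)) \<in> Linf M"
  then obtain b where b: "AE x in M. \<bar>real_of_ereal (1 / g x)\<bar> \<le> b"
    by (auto simp: Linf_def)
  \<comment> \<open>Inverting the bound on the reciprocal; the maximum with 1 keeps the resulting
    constant positive.\<close>
  have "AE x in M. ereal (1 / max b 1) \<le> g x"
    using pos b
  proof eventually_elim
    case (elim x)
    show ?case
    proof (cases "g x")
      case (real r)
      then have "0 < r" "1 / r \<le> max b 1"
        using elim by (auto simp: one_ereal_def)
      then show ?thesis
        using real by (simp add: field_simps)
    qed (use elim in auto)
  qed
  then show "\<exists>c>0. AE x in M. ereal c \<le> g x"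
    by (intro exI[of _ "1 / max b 1"]) auto
qed

theorem theorem4p1:
  fixes M F0 :: "'a measure"
    and \<rho> :: "('a \<Rightarrow> real) \<Rightarrow> real"
    and v :: "'a \<Rightarrow> real"
  assumes "relevant_fatou_coherent_risk_measure M \<rho>"
    and "subalgebra M F0"
    and "v \<in> Linf_plus M"
  shows "(AE x in M. lambda0 M F0 \<rho> v x = - rho0 M F0 \<rho> (\<lambda>x. - v x) x) \<and>
         (v \<in> numeraires0 M F0 \<rho> \<longleftrightarrow>
            (AE x in M. lambda0 M F0 \<rho> v x > 0) \<and>
            (\<lambda>x. real_of_ereal (1 / lambda0 M F0 \<rho> v x)) \<in> Linf M)"
proof -
  have M: "prob_space M"
    using assms(1) by (simp add: relevant_fatou_coherent_risk_measure_def)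
  have "lambda0 M F0 \<rho> v \<in> borel_measurable M"
    using is_ess_Inf_lambda0[OF M assms(2)] by (simp add: is_ess_Inf_def)
  moreover have "v \<in> Linf M"
    using assms(3) by (simp add: Linf_plus_def)
  ultimately show ?thesis
    using lambda0_eq_uminus_rho0[OF M assms(2)] one_divide_in_Linf_iff
    by (simp add: numeraires0_iff[OF M assms(2,3)])
qed

end
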